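(* Let $n\geq 1$ and let $S\subseteq M_n(\mathbb Q)$ be a finite irreducible semigroup of $n\times n$ rational matrices under matrix multiplication, with $S\neq\{0\}$. Then $|S|\leq 3^{n^2}$. Moreover, let $I$ be the unique $0$-minimal ideal of $S$ if $0\in S$, and the unique minimal ideal of $S$ if $0\notin S$, and let $G$ be a maximal subgroup of $I$ contained in $I\setminus\{0\}$. If $G$ has odd order (in particular, if $S$ is aperiodic), then $|S|\leq 2^{n^2}$.
   Context: $M_n(\mathbb Q)$ denotes the multiplicative semigroup of all $n\times n$ matrices over $\mathbb Q$, and $0$ denotes the zero matrix. A semigroup $S\subseteq M_n(\mathbb Q)$ is a nonempty subset closed under matrix multiplication; it is not required to contain the identity matrix. It is irreducible if it has no nontrivial invariant subspace, i.e. the only subspaces $W\subseteq\mathbb Q^n$ with $sW\subseteq W$ for all $s\in S$ are $\{0\}$ and $\mathbb Q^n$. An ideal of a semigroup $S$ is a nonempty subset $I$ with $SI\subseteq I$ and $IS\subseteq I$. If $0\in S$, a $0$-minimal ideal is an ideal $I\neq\{0\}$ that contains no proper nonzero ideal of $S$ (the only ideals of $S$ contained in $I$ are $\{0\}$ and $I$). A finite irreducible semigroup $S\neq\{0\}$ containing $0$ has a unique $0$-minimal ideal; a finite semigroup not containing $0$ has a unique minimal ideal (an ideal containing no ideal properly). A maximal subgroup is a subsemigroup that is a group under the semigroup multiplication (its identity element is an idempotent matrix, not necessarily the identity matrix) and that is maximal with respect to inclusion among such subsemigroups. For $I$ as in the claim, $I\setminus\{0\}$ contains a maximal subgroup, and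 any two maximal subgroups of $I$ contained in $I\setminus\{0\}$ are isomorphic, so the order of $G$ does not depend on the choice. A semigroup is aperiodic if all its maximal subgroups are trivial. *)

theory Defs
  imports "HOL-Analysis.Analysis" "HOL-Algebra.Group"
begin

definition matrix_semigroup :: "(rat ^ 'n ^ 'n) set \<Rightarrow> bool" where
  "matrix_semigroup S \<longleftrightarrow> S \<noteq> {} \<and> (\<forall>a\<in>S. \<forall>b\<in>S. a ** b \<in> S)"

definition matrix_irreducible :: "(rat ^ 'n ^ 'n) set \<Rightarrow> bool" where
  "matrix_irreducible S \<longleftrightarrow>
     (\<forall>W. vec.subspace W \<and> (\<forall>s\<in>S. (\<lambda>x. s *v x) ` W \<subseteq> W) \<longrightarrow> W = {0} \<or> W = UNIV)"

definition matrix_ideal :: "(rat ^ 'n ^ 'n) set \<Rightarrow> (rat ^ 'n ^ 'n) set \<Rightarrow> bool" where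
  "matrix_ideal S I \<longleftrightarrow> I \<noteq> {} \<and> I \<subseteq> S \<and> (\<forall>s\<in>S. \<forall>x\<in>I. s ** x \<in> I \<and> x ** s \<in> I)"

definition minimal_ideal :: "(rat ^ 'n ^ 'n) set \<Rightarrow> (rat ^ 'n ^ 'n) set \<Rightarrow> bool" where
  "minimal_ideal S I \<longleftrightarrow> matrix_ideal S I \<and> (\<forall>J. matrix_ideal S J \<and> J \<subseteq> I \<longrightarrow> J = I)"

definition zero_minimal_ideal :: "(rat ^ 'n ^ 'n) set \<Rightarrow> (rat ^ 'n ^ 'n) set \<Rightarrow> bool" where
  "zero_minimal_ideal S I \<longleftrightarrow> 0 \<in> S \<and> matrix_ideal S I \<and> I \<noteq> {0} \<and>
     (\<forall>J. matrix_ideal S J \<and> J \<subseteq> I \<longrightarrow> J = {0} \<or> J = I)"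

text \<open>The identity \<open>e\<close> of a group of matrices is an idempotent, not necessarily \<open>mat 1\<close>.\<close>

definition matrix_group :: "(rat ^ 'n ^ 'n) set \<Rightarrow> bool" where
  "matrix_group G \<longleftrightarrow> (\<exists>e. group \<lparr>carrier = G, mult = (**), one = e\<rparr>)"

definition maximal_subgroup :: "(rat ^ 'n ^ 'n) set \<Rightarrow> (rat ^ 'n ^ 'n) set \<Rightarrow> bool" where
  "maximal_subgroup T G \<longleftrightarrow> G \<subseteq> T \<and> matrix_group G \<and>
     (\<forall>H. H \<subseteq> T \<and> matrix_group H \<and> G \<subseteq> H \<longrightarrow> H = G)"

definition aperiodic :: "(rat ^ 'n ^ 'n) set \<Rightarrow> bool" where
  "aperiodic S \<longleftrightarrow> (\<forall>G. maximal_subgroup S G \<longrightarrow> (\<exists>e. G = {e}))"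

end

theory Submission
  imports Defs "HOL-Algebra.Multiplicative_Group" "HOL-Computational_Algebra.Primes"
begin

text \<open>
  The bounds come from Minkowski's reduction modulo \<open>p\<close>, with \<open>p = 3\<close> in general and \<open>p = 2\<close> for odd
  order. Let \<open>R\<close> be the additive group generated by \<open>S\<close>. It is closed under multiplication, and its
  elements have bounded denominators. A linear relation over the rationals between elements of \<open>R\<close>
  can be made integral and primitive, so it remains nontrivial modulo \<open>p\<close>. Hence \<open>R/pR\<close> has dimension
  at most \<open>n\<^sup>2\<close> over the field with \<open>p\<close> elements, and it suffices that distinct elements of \<open>S\<close> are
  incongruent modulo \<open>pR\<close> (lemma \<open>card_le_of_incongruent_matrices\<close>).

  To see this, take a nonzero idempotent \<open>e\<close> in \<open>S\<close> such that all nonzero elements of \<open>eSe\<close> have the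
  rank of \<open>e\<close>; one exists by \<open>ex_rank_minimal_idempotent\<close>. Finiteness makes \<open>H = eSe - {0}\<close> a group with
  identity \<open>e\<close> (\<open>group_local_group\<close>). By irreducibility, distinct \<open>s\<close> and \<open>t\<close> in \<open>S\<close> satisfy
  \<open>eusve \<noteq> eutve\<close> for some \<open>u\<close> and \<open>v\<close> in \<open>S\<close> (\<open>irreducible_compression_separates\<close>). If \<open>s\<close> and \<open>t\<close> were
  congruent, there would be two distinct congruent elements in \<open>H \<union> {0}\<close>. An element of \<open>H\<close>
  congruent to \<open>0\<close> would make \<open>e = e\<^sup>a\<close> divisible by all powers of \<open>p\<close>, which bounded denominators
  exclude; two congruent elements of \<open>H\<close> have a quotient congruent to \<open>e\<close>. So all depends on \<open>e\<close> being
  the only element \<open>k\<close> of \<open>H\<close> congruent to \<open>e\<close>. This follows by improving the congruence from \<open>p\<^sup>a\<close> to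
  \<open>p\<^sup>a\<^sup>+\<^sup>1\<close> indefinitely, in two cases: when the order of \<open>k\<close> is prime to \<open>p\<close>
  (\<open>congruent_one_coprime_order\<close>), and when \<open>p = 3\<close> and \<open>k\<^sup>3 = e\<close> (\<open>congruent_one_cube\<close>). Together they
  settle \<open>p = 3\<close>; the first alone settles \<open>p = 2\<close> when \<open>H\<close> has odd order.

  Finally, the maximal subgroup \<open>G\<close> of the minimal or 0-minimal ideal is itself of the form
  \<open>eSe - {0}\<close> (\<open>maximal_subgroup_of_minimal_ideal\<close>), so its order is that of such an \<open>H\<close>. In the
  aperiodic case \<open>H\<close> is a maximal subgroup of \<open>S\<close> and is therefore trivial.
\<close>

section \<open>Integer spans and congruences\<close>

text \<open>
  The subgroups of an abelian group are its integer submodules. On vectors and matrices over a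
  ring the product \<open>*\<close> acts entrywise and \<open>of_int c\<close> is the constant array \<open>c\<close>, so that
  \<open>of_int c * x\<close> is the scalar multiple of \<open>x\<close> by \<open>c\<close>; \<open>**\<close> remains the matrix product.
\<close>

interpretation zmod: Modules.module "\<lambda>(c::int) (x::'a::ring_1). of_int c * x"
  by unfold_locales (simp_all add: algebra_simps)

text \<open>As a rewrite rule \<open>scale_scale\<close> is undone by \<open>of_int_mult\<close> and conflicts with associativity.\<close>

lemmas [simp del] = zmod.scale_scale

text \<open>
  The subgroup \<open>qR\<close> of \<open>R\<close>: congruence of \<open>x\<close> and \<open>y\<close> modulo \<open>q\<close> means \<open>x - y \<in> multiples q R\<close>.
\<close>

definition multiples :: "int \<Rightarrow> 'a::ring_1 set \<Rightarrow> 'a set" where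
  "multiples q R = (\<lambda>r. of_int q * r) ` R"

lemma of_int_index_vec: "(of_int c :: 'a::ring_1 ^ 'k) $ i = of_int c"
  by (cases c rule: int_diff_cases) (simp add: of_nat_index)

lemma subspace_multiples:
  assumes "zmod.subspace R"
  shows "zmod.subspace (multiples q R)"
proof (rule zmod.subspaceI)
  show "0 \<in> multiples q R"
    using zmod.subspace_0[OF assms] by (force simp: multiples_def)
  show "x + y \<in> multiples q R" if "x \<in> multiples q R" "y \<in> multiples q R" for x y
    using that zmod.subspace_add[OF assms]
    by (auto simp: multiples_def simp flip: distrib_left)
  show "of_int c * x \<in> multiples q R" if x: "x \<in> multiples q R" for c x
  proof -
    obtain r where "r \<in> R" "x = of_int q * r" using x by (auto simp: multiples_def)
    moreover have "of_int c * (of_int q * r) = of_int q * (of_int c * r)"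
      using zmod.scale_left_commute by blast
    ultimately show ?thesis
      using zmod.subspace_scale[OF assms] unfolding multiples_def by (metis image_eqI)
  qed
qed

lemma multiples_subset: "zmod.subspace R \<Longrightarrow> multiples q R \<subseteq> R"
  by (auto simp: multiples_def zmod.subspace_scale)

lemma common_denominator:
  assumes "finite (X :: rat set)"
  shows "\<exists>D::int. D > 0 \<and> (\<forall>x\<in>X. of_int D * x \<in> \<int>)"
  using assms
proof (induction X)
  case empty
  show ?case by (intro exI[of _ 1]) auto
next
  case (insert x X)
  then obtain D :: int where D: "D > 0" "\<forall>x\<in>X. of_int D * x \<in> \<int>" by blast
  obtain a b :: int where ab: "x = of_int a / of_int b" "b > 0"
    by (metis quotient_of_denom_pos quotient_of_div surj_pair)
  show ?case
  proof (intro exI[of _ "D * b"] conjI ballI)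
    fix y assume "y \<in> insert x X"
    then consider "y = x" | "y \<in> X" by blast
    then show "of_int (D * b) * y \<in> \<int>"
    proof cases
      case 1
      then have "of_int (D * b) * y = of_int (D * a)" using ab by simp
      then show ?thesis by (metis Ints_of_int)
    next
      case 2
      then have "of_int b * (of_int D * y) \<in> \<int>" using D 2 by - (rule Ints_mult[OF Ints_of_int], blast)
      then show ?thesis by (metis of_int_mult mult.assoc mult.commute)
    qed
  qed (use D ab in simp)
qed

text \<open>
  Clearing denominators and dividing by the greatest common divisor makes a nontrivial rational
  relation integral and nontrivial modulo \<open>p\<close>.
\<close>

lemma rational_relation_primitive:
  fixes u :: "'b \<Rightarrow> rat" and p :: int
  assumes B: "finite B" and nz: "b\<^sub>0 \<in> B" "u b\<^sub>0 \<noteq> 0" and p: "\<not> is_unit p"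
  obtains c :: "'b \<Rightarrow> int" and l :: rat
  where "\<forall>b\<in>B. of_int (c b) = l * u b" "\<exists>b\<in>B. \<not> p dvd c b"
proof -
  obtain D :: int where D: "D > 0" "\<forall>x\<in>u ` B. of_int D * x \<in> \<int>"
    using common_denominator[of "u ` B"] B by blast
  have "\<forall>b\<in>B. \<exists>k. of_int D * u b = of_int k"
    using D(2) by (metis Ints_cases image_eqI)
  then obtain d where d: "\<forall>b\<in>B. of_int D * u b = of_int (d b)" by metis
  define g where "g = Gcd (d ` B)"
  have "d b\<^sub>0 \<noteq> 0" using d nz D(1) by (metis mult_eq_0_iff of_int_0_eq_iff less_irrefl)
  then have g: "g \<noteq> 0" using nz(1) by (auto simp: g_def Gcd_0_iff)
  have gd: "d b = g * (d b div g)" if "b \<in> B" for b using that by (simp add: g_def)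
  show thesis
  proof (rule that[of "\<lambda>b. d b div g" "of_int D / of_int g"])
    show "\<forall>b\<in>B. of_int (d b div g) = of_int D / of_int g * u b"
    proof
      fix b assume b: "b \<in> B"
      have "of_int D * u b = of_int g * of_int (d b div g)"
        using d b gd[OF b] by (metis of_int_mult)
      then show "of_int (d b div g) = of_int D / of_int g * u b"
        using g by (simp add: field_simps)
    qed
    show "\<exists>b\<in>B. \<not> p dvd d b div g"
    proof (rule ccontr)
      assume "\<not> ?thesis"
      then have "\<forall>b\<in>B. g * p dvd d b" using gd by (metis dvd_refl mult_dvd_mono)
      then have "g * p dvd g" unfolding g_def by (intro Gcd_greatest) auto
      then show False using g p by simp
    qed
  qed
qed

text \<open>
  The quotient \<open>R/pR\<close> is a vector space over the field with \<open>p\<close> elements, of dimension at most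
  that of the rational span of \<open>R\<close>: a rational relation, made primitive, survives modulo \<open>p\<close>.
  The proof picks a smallest subset \<open>B\<close>
  of \<open>S\<close> that generates \<open>S\<close> modulo \<open>pR\<close>; such a \<open>B\<close> is linearly independent over the rationals,
  and an element of \<open>S\<close> is determined by its coefficients modulo \<open>p\<close> with respect to \<open>B\<close>.
\<close>

lemma card_le_of_incongruent:
  fixes S :: "(rat ^ 'k) set" and p :: int
  assumes R: "zmod.subspace R" and S: "finite S" "S \<subseteq> R" and p: "prime p"
    and inj: "\<And>s t. s \<in> S \<Longrightarrow> t \<in> S \<Longrightarrow> s - t \<in> multiples p R \<Longrightarrow> s = t"
  shows "card S \<le> nat p ^ CARD('k)"
proof -
  define gen where "gen B \<longleftrightarrow> (\<forall>s\<in>S. \<exists>c :: rat ^ 'k \<Rightarrow> int. \<exists>r\<in>R.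
      s = (\<Sum>b\<in>B. of_int (c b) * b) + of_int p * r)" for B
  have p1: "p > 1" using p by (rule prime_gt_1_int)
  have "gen S"
    unfolding gen_def
  proof
    fix s assume s: "s \<in> S"
    have "(\<Sum>b\<in>S. of_int (if b = s then 1 else 0) * b) = (\<Sum>b\<in>S. if b = s then s else 0)"
      by (intro sum.cong) auto
    then have "s = (\<Sum>b\<in>S. of_int (if b = s then 1 else 0) * b) + of_int p * 0"
      using s S(1) by simp
    then show "\<exists>c. \<exists>r\<in>R. s = (\<Sum>b\<in>S. of_int (c b) * b) + of_int p * r"
      using zmod.subspace_0[OF R] by (intro exI bexI)
  qed
  then have "\<exists>B. (B \<subseteq> S \<and> gen B) \<and> (\<forall>B'. B' \<subseteq> S \<and> gen B' \<longrightarrow> card B \<le> card B')"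
    by (intro ex_has_least_nat[of "\<lambda>B. B \<subseteq> S \<and> gen B" S card]) auto
  then obtain B where BS: "B \<subseteq> S" and gB: "gen B"
    and least: "\<And>B'. B' \<subseteq> S \<Longrightarrow> gen B' \<Longrightarrow> card B \<le> card B'"
    by blast
  have fB: "finite B" using BS S(1) by (rule finite_subset)
  have "vec.independent B"
  proof
    assume "vec.dependent B"
    then obtain u b\<^sub>1 where u: "(\<Sum>b\<in>B. u b *s b) = 0" "b\<^sub>1 \<in> B" "u b\<^sub>1 \<noteq> 0"
      using vec.dependent_finite[OF fB] by auto
    obtain c :: "rat ^ 'k \<Rightarrow> int" and l where c: "\<forall>b\<in>B. of_int (c b) = l * u b" "\<exists>b\<in>B. \<not> p dvd c b"
      using rational_relation_primitive[of B b\<^sub>1 u p] fB u(2,3) p by (metis not_prime_unit)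
    then obtain b\<^sub>0 where b0: "b\<^sub>0 \<in> B" "\<not> p dvd c b\<^sub>0" by blast
    have "(\<Sum>b\<in>B. of_int (c b) * b) = (\<Sum>b\<in>B. l *s (u b *s b))"
      using c(1) by (intro sum.cong) (auto simp: vec_eq_iff of_int_index_vec)
    also have "\<dots> = l *s (\<Sum>b\<in>B. u b *s b)" by (simp add: vec.scale_sum_right)
    finally have rel: "(\<Sum>b\<in>B. of_int (c b) * b) = 0" by (simp add: u(1))
    \<comment> \<open>The coefficient of \<open>b\<^sub>0\<close> is invertible modulo \<open>p\<close>, so \<open>b\<^sub>0\<close> is redundant as a generator.\<close>
    have "coprime (c b\<^sub>0) p" using b0(2) p by (simp add: coprime_commute prime_imp_coprime)
    then obtain v w where vw: "v * c b\<^sub>0 + w * p = 1"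
      using bezout_int[of "c b\<^sub>0" p] by auto
    define B' where "B' = B - {b\<^sub>0}"
    have sumB: "(\<Sum>b\<in>B. f b) = f b\<^sub>0 + (\<Sum>b\<in>B'. f b)" for f :: "rat ^ 'k \<Rightarrow> rat ^ 'k"
      unfolding B'_def using fB b0(1) by (rule sum.remove)
    have b0R: "b\<^sub>0 \<in> R" using b0(1) BS S(2) by blast
    have c0: "of_int (c b\<^sub>0) * b\<^sub>0 = - (\<Sum>b\<in>B'. of_int (c b) * b)"
      using rel sumB[of "\<lambda>b. of_int (c b) * b"] by (simp add: eq_neg_iff_add_eq_0)
    have b0eq: "b\<^sub>0 = of_int p * (of_int w * b\<^sub>0) - (\<Sum>b\<in>B'. of_int (v * c b) * b)"
    proof -
      have "b\<^sub>0 = of_int (v * c b\<^sub>0 + w * p) * b\<^sub>0" by (simp only: vw of_int_1 mult_1)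
      also have "\<dots> = of_int v * (of_int (c b\<^sub>0) * b\<^sub>0) + of_int p * (of_int w * b\<^sub>0)"
        by (simp add: distrib_right mult.assoc mult.left_commute)
      also have "of_int v * (of_int (c b\<^sub>0) * b\<^sub>0) = - (\<Sum>b\<in>B'. of_int (v * c b) * b)"
        unfolding c0 by (simp add: sum_distrib_left mult.assoc)
      finally show ?thesis by simp
    qed
    have "gen B'"
      unfolding gen_def
    proof
      fix s assume "s \<in> S"
      then obtain a r where r: "r \<in> R" and s: "s = (\<Sum>b\<in>B. of_int (a b) * b) + of_int p * r"
        using gB unfolding gen_def by blast
      have "of_int (a b\<^sub>0) * b\<^sub>0
          = of_int p * (of_int (a b\<^sub>0 * w) * b\<^sub>0) - (\<Sum>b\<in>B'. of_int (a b\<^sub>0 * (v * c b)) * b)"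
        by (subst b0eq)
          (simp add: right_diff_distrib sum_distrib_left mult.assoc mult.left_commute)
      then have "s = (\<Sum>b\<in>B'. of_int (a b - a b\<^sub>0 * (v * c b)) * b)
          + of_int p * (r + of_int (a b\<^sub>0 * w) * b\<^sub>0)"
        unfolding s sumB
        by (simp add: left_diff_distrib sum_subtractf distrib_left)
      moreover have "r + of_int (a b\<^sub>0 * w) * b\<^sub>0 \<in> R"
        using R r b0R zmod.subspace_add zmod.subspace_scale by blast
      ultimately show "\<exists>c. \<exists>r\<in>R. s = (\<Sum>b\<in>B'. of_int (c b) * b) + of_int p * r"
        by (intro exI bexI)
    qed
    then have "card B \<le> card B'" using BS by (intro least) (auto simp: B'_def)
    then show False using card_Diff1_less[OF fB b0(1)] by (simp add: B'_def)
  qed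
  then have cB: "card B \<le> CARD('k)"
    using vec.independent_card_le_dim[of B UNIV] by (simp add: card_cart_basis)
  obtain a where "\<forall>s\<in>S. \<exists>r\<in>R. s = (\<Sum>b\<in>B. of_int (a s b) * b) + of_int p * r"
    using bchoice[OF gB[unfolded gen_def]] by blast
  then obtain r where "\<forall>s\<in>S. r s \<in> R \<and> s = (\<Sum>b\<in>B. of_int (a s b) * b) + of_int p * r s"
    using bchoice[of S "\<lambda>s r. r \<in> R \<and> s = (\<Sum>b\<in>B. of_int (a s b) * b) + of_int p * r"]
    unfolding Bex_def by blast
  then have r: "\<And>s. s \<in> S \<Longrightarrow> r s \<in> R"
    and a: "\<And>s. s \<in> S \<Longrightarrow> s = (\<Sum>b\<in>B. of_int (a s b) * b) + of_int p * r s"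
    by blast+
  define f where "f s = (\<lambda>b\<in>B. a s b mod p)" for s
  have "inj_on f S"
  proof (rule inj_onI)
    fix s t assume s: "s \<in> S" and t: "t \<in> S" and "f s = f t"
    then have "a s b mod p = a t b mod p" if "b \<in> B" for b
      unfolding f_def by (metis restrict_apply' that)
    then have "\<forall>b\<in>B. \<exists>k. a s b - a t b = p * k" by (metis dvd_def mod_eq_dvd_iff)
    then obtain k where k: "\<And>b. b \<in> B \<Longrightarrow> a s b - a t b = p * k b" by metis
    have "s - t = (\<Sum>b\<in>B. of_int (a s b - a t b) * b) + of_int p * (r s - r t)"
      by (subst a[OF s], subst a[OF t])
        (simp add: left_diff_distrib right_diff_distrib sum_subtractf)
    also have "(\<Sum>b\<in>B. of_int (a s b - a t b) * b) = (\<Sum>b\<in>B. of_int p * (of_int (k b) * b))"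
      by (intro sum.cong) (simp_all only: k of_int_mult mult.assoc)
    finally have "s - t = of_int p * ((\<Sum>b\<in>B. of_int (k b) * b) + (r s - r t))"
      by (simp add: distrib_left sum_distrib_left)
    moreover have "(\<Sum>b\<in>B. of_int (k b) * b) + (r s - r t) \<in> R"
    proof -
      have "(\<Sum>b\<in>B. of_int (k b) * b) \<in> R"
        using BS S(2) R by (intro zmod.subspace_sum zmod.subspace_scale) auto
      then show ?thesis using R r s t by (simp add: zmod.subspace_add zmod.subspace_diff)
    qed
    ultimately show "s = t" using inj[OF s t] by (auto simp: multiples_def)
  qed
  moreover have "f ` S \<subseteq> B \<rightarrow>\<^sub>E {0..<p}" using p1 by (auto simp: f_def)
  ultimately have "card S \<le> card (B \<rightarrow>\<^sub>E {0..<p})"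
    using fB by (intro card_inj_on_le[of f]) (auto intro: finite_PiE)
  also have "\<dots> = nat p ^ card B" using fB by (simp add: card_PiE)
  also have "\<dots> \<le> nat p ^ CARD('k)" using cB p1 by (intro power_increasing) auto
  finally show ?thesis .
qed

text \<open>
  Over the rationals the matrices form a vector space whose dimension is the number of entries:
  pairing the two indices turns a matrix into a vector.
\<close>

definition flatten :: "'a ^ 'n ^ 'm \<Rightarrow> 'a ^ ('m \<times> 'n)" where
  "flatten A = (\<chi> ij. A $ fst ij $ snd ij)"

lemma card_le_of_incongruent_matrices:
  fixes S :: "(rat ^ 'n ^ 'm) set" and p :: int
  assumes R: "zmod.subspace R" and S: "finite S" "S \<subseteq> R" and p: "prime p"
    and inj: "\<And>s t. s \<in> S \<Longrightarrow> t \<in> S \<Longrightarrow> s - t \<in> multiples p R \<Longrightarrow> s = t"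
  shows "card S \<le> nat p ^ (CARD('m) * CARD('n))"
proof -
  have inj_f: "inj (flatten :: rat ^ 'n ^ 'm \<Rightarrow> _)"
    by (auto intro!: injI simp: flatten_def vec_eq_iff)
  have add: "flatten (x + y) = flatten x + flatten y"
    and diff: "flatten (x - y) = flatten x - flatten y"
    and scale: "flatten (of_int c * x) = of_int c * flatten x"
    and zero: "flatten 0 = (0 :: rat ^ ('m \<times> 'n))"
    for x y :: "rat ^ 'n ^ 'm" and c
    by (simp_all add: flatten_def vec_eq_iff of_int_index_vec)
  have "card (flatten ` S) \<le> nat p ^ CARD('m \<times> 'n)"
  proof (rule card_le_of_incongruent[OF _ _ _ p])
    show "zmod.subspace (flatten ` R)"
    proof (rule zmod.subspaceI)
      show "0 \<in> flatten ` R" using zmod.subspace_0[OF R] zero by (metis image_eqI)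
      show "x + y \<in> flatten ` R" if "x \<in> flatten ` R" "y \<in> flatten ` R" for x y
        using that zmod.subspace_add[OF R] by (auto simp flip: add)
      show "of_int c * x \<in> flatten ` R" if "x \<in> flatten ` R" for c x
        using that zmod.subspace_scale[OF R] by (auto simp flip: scale)
    qed
    fix x y assume "x \<in> flatten ` S" "y \<in> flatten ` S"
      and xy: "x - y \<in> multiples p (flatten ` R)"
    then obtain s t where st: "s \<in> S" "t \<in> S" "x = flatten s" "y = flatten t" by blast
    obtain r where "r \<in> R" "flatten (s - t) = flatten (of_int p * r)"
      using xy unfolding st multiples_def by (auto simp: diff scale)
    then have "s - t \<in> multiples p R" using inj_f by (auto simp: multiples_def dest: injD)
    then show "x = y" using inj[OF st(1,2)] st(3,4) by simp
  qed (use S in auto)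
  then show ?thesis using inj_f by (simp add: card_image inj_on_subset)
qed

section \<open>The order spanned by a finite matrix semigroup\<close>

lemma matrix_mult_minus_distrib:
  fixes A B C :: "'a::ring_1 ^ 'n ^ 'n"
  shows "A ** (B - C) = A ** B - A ** C" "(B - C) ** A = B ** A - C ** A"
  by (simp_all add: matrix_matrix_mult_def vec_eq_iff algebra_simps sum_subtractf)

lemma matrix_add_rdistrib:
  fixes A B C :: "'a::semiring_1 ^ 'n ^ 'n"
  shows "(B + C) ** A = B ** A + C ** A"
  by (simp add: matrix_matrix_mult_def vec_eq_iff distrib_right sum.distrib)

lemma matrix_mult_of_int:
  fixes A B :: "'a::comm_ring_1 ^ 'n ^ 'n"
  shows "(of_int c * A) ** B = of_int c * (A ** B)" "A ** (of_int c * B) = of_int c * (A ** B)"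
  by (simp_all add: matrix_matrix_mult_def vec_eq_iff of_int_index_vec sum_distrib_left mult_ac)

lemma matrix_of_int_cancel:
  fixes A B :: "rat ^ 'n ^ 'm"
  assumes "of_int c * A = of_int c * B" "c \<noteq> 0"
  shows "A = B"
  using assms by (simp add: vec_eq_iff of_int_index_vec)

text \<open>
  The integer span of a multiplicative semigroup is a ring, perhaps without the identity matrix.
\<close>

lemma zmod_span_mult_closed:
  fixes S :: "(rat ^ 'n ^ 'n) set"
  assumes S: "\<And>a b. a \<in> S \<Longrightarrow> b \<in> S \<Longrightarrow> a ** b \<in> S"
    and x: "x \<in> zmod.span S" and y: "y \<in> zmod.span S"
  shows "x ** y \<in> zmod.span S"
proof -
  have left: "a ** y \<in> zmod.span S" if a: "a \<in> S" for a
    using y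
  proof (induction rule: zmod.span_induct_alt)
    case base
    show ?case by (simp add: zmod.span_zero)
  next
    case (step c b z)
    have "of_int c * (a ** b) \<in> zmod.span S"
      using S[OF a step(1)] by (intro zmod.span_scale zmod.span_base)
    with step(2) show ?case
      by (simp add: matrix_add_ldistrib matrix_mult_of_int zmod.span_add)
  qed
  show ?thesis
    using x
  proof (induction rule: zmod.span_induct_alt)
    case base
    show ?case by (simp add: zmod.span_zero)
  next
    case (step c b z)
    then show ?case
      using left[of b]
      by (simp add: matrix_add_rdistrib matrix_mult_of_int zmod.span_add zmod.span_scale)
  qed
qed

text \<open>
  This is where finiteness of \<open>S\<close> enters the arithmetic: the entries of the elements of the span
  have a common denominator \<open>D\<close>, so each entry of \<open>x\<close> times \<open>D\<close> is an integer divisible by every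
  power of \<open>p\<close>.
\<close>

lemma zmod_span_separated:
  fixes S :: "(rat ^ 'n ^ 'm) set"
  assumes S: "finite S" and p: "p > 1"
    and x: "\<And>a. x \<in> multiples (p ^ a) (zmod.span S)"
  shows "x = 0"
proof -
  have "finite (\<Union>s\<in>S. \<Union>i. \<Union>j. {s $ i $ j})" using S by simp
  then obtain D :: int where D: "D > 0"
    and D': "\<forall>y\<in>(\<Union>s\<in>S. \<Union>i. \<Union>j. {s $ i $ j}). of_int D * y \<in> \<int>"
    using common_denominator by metis
  have int: "of_int D * r $ i $ j \<in> \<int>" if "r \<in> zmod.span S" for r i j
    using that
  proof (induction rule: zmod.span_induct_alt)
    case (step c b z)
    have "of_int c * (of_int D * b $ i $ j) \<in> \<int>"
      using D' step(1) by - (rule Ints_mult[OF Ints_of_int], blast)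
    from this step(2) have "of_int c * (of_int D * b $ i $ j) + of_int D * z $ i $ j \<in> \<int>"
      by (rule Ints_add)
    then show ?case by (simp add: of_int_index_vec algebra_simps)
  qed simp
  have "x $ i $ j = 0" for i j
  proof -
    have ex: "\<exists>m. of_int D * x $ i $ j = of_int (p ^ a * m)" for a
    proof -
      obtain r where r: "r \<in> zmod.span S" "x = of_int (p ^ a) * r"
        using x[of a] by (auto simp: multiples_def)
      obtain m where "of_int D * r $ i $ j = of_int m" using int[OF r(1), of i j] by (auto elim: Ints_cases)
      then have "of_int D * x $ i $ j = of_int (p ^ a * m)"
        unfolding r(2) by (simp add: of_int_index_vec flip: of_int_power)
      then show ?thesis by blast
    qed
    from ex[of 0] obtain k where k: "of_int D * x $ i $ j = of_int k" by auto
    have dvd: "p ^ a dvd k" for a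
      using ex[of a] unfolding k by (metis dvd_triv_left of_int_eq_iff)
    have "k = 0"
    proof (rule ccontr)
      assume "k \<noteq> 0"
      have "p ^ nat \<bar>k\<bar> \<le> \<bar>k\<bar>" using dvd \<open>k \<noteq> 0\<close> p
        by (metis abs_of_nonneg dvd_imp_le_int less_imp_le order_less_le_trans zero_le_power zero_less_one)
      moreover have "int (nat \<bar>k\<bar>) < 2 ^ nat \<bar>k\<bar>"
        by (metis less_exp of_nat_less_iff of_nat_numeral of_nat_power)
      moreover have "(2::int) ^ nat \<bar>k\<bar> \<le> p ^ nat \<bar>k\<bar>" using p by (intro power_mono) auto
      ultimately show False by linarith
    qed
    then show ?thesis using k D by simp
  qed
  then show ?thesis by (simp add: vec_eq_iff)
qed

lemma multiples_mult:
  fixes R :: "(rat ^ 'n ^ 'n) set"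
  assumes R: "\<And>a b. a \<in> R \<Longrightarrow> b \<in> R \<Longrightarrow> a ** b \<in> R"
    and "x \<in> multiples q R" "y \<in> multiples q' R"
  shows "x ** y \<in> multiples (q * q') R"
proof -
  obtain a b where ab: "a \<in> R" "b \<in> R" "x = of_int q * a" "y = of_int q' * b"
    using assms(2,3) by (auto simp: multiples_def)
  have "x ** y = of_int (q * q') * (a ** b)"
    by (simp add: ab(3,4) matrix_mult_of_int mult.assoc)
  then show ?thesis using R[OF ab(1,2)] by (auto simp: multiples_def)
qed

lemma multiples_one: "multiples 1 R = R"
  by (simp add: multiples_def)

lemma multiples_mono:
  assumes "zmod.subspace R" "q dvd q'"
  shows "multiples q' R \<subseteq> multiples q R"
proof
  fix x assume "x \<in> multiples q' R"
  then obtain r where "r \<in> R" "x = of_int q' * r" by (auto simp: multiples_def)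
  moreover obtain k where "q' = q * k" using assms(2) by blast
  ultimately  show "x \<in> multiples q R"
    using zmod.subspace_scale[OF assms(1), of r k]
    unfolding multiples_def by (metis image_eqI mult.assoc of_int_mult)
qed

section \<open>Elements of finite order congruent to the identity\<close>

text \<open>
  If \<open>e \<in> pR\<close> then \<open>e = e\<^sup>a\<close> lies in \<open>p\<^sup>aR\<close> for all \<open>a\<close>.
\<close>

lemma idempotent_not_multiple:
  fixes R :: "(rat ^ 'n ^ 'n) set"
  assumes R: "\<And>a b. a \<in> R \<Longrightarrow> b \<in> R \<Longrightarrow> a ** b \<in> R"
    and sep: "\<And>x. (\<And>a. x \<in> multiples (p ^ a) R) \<Longrightarrow> x = 0"
    and e: "e ** e = e" "e \<in> multiples p R" and sub: "multiples p R \<subseteq> R"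
  shows "e = 0"
proof (rule sep)
  show "e \<in> multiples (p ^ a) R" for a
  proof (induction a)
    case 0
    show ?case using e sub by (auto simp: multiples_one)
  next
    case (Suc a)
    then show ?case using multiples_mult[OF R e(2) Suc] e(1) by simp
  qed
qed

text \<open>
  The part of Minkowski's argument for order prime to \<open>p\<close>. With \<open>d = k - e\<close> divisible by \<open>p\<^sup>a\<close> and
  \<open>a \<ge> 1\<close>, the square \<open>d\<^sup>2\<close> is divisible by \<open>p\<^sup>a\<^sup>+\<^sup>1\<close>, so that \<open>k\<^sup>j \<equiv> e + jd\<close> modulo \<open>p\<^sup>a\<^sup>+\<^sup>1\<close>.
  For \<open>j = m\<close> this gives \<open>md \<equiv> 0\<close>, and as \<open>m\<close> is invertible modulo \<open>p\<close>, \<open>d\<close> is divisible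
  by \<open>p\<^sup>a\<^sup>+\<^sup>1\<close>. The group \<open>H\<close> has its own identity \<open>e\<close>, an idempotent of \<open>R\<close>.
\<close>

lemma congruent_one_coprime_order:
  fixes H R :: "(rat ^ 'n ^ 'n) set" and p :: int and e
  defines "\<Gamma> \<equiv> \<lparr>carrier = H, mult = (**), one = e\<rparr>"
  assumes grp: "group \<Gamma>" and R: "zmod.subspace R" "\<And>a b. a \<in> R \<Longrightarrow> b \<in> R \<Longrightarrow> a ** b \<in> R"
    and sep: "\<And>x. (\<And>a. x \<in> multiples (p ^ a) R) \<Longrightarrow> x = 0"
    and HR: "H \<subseteq> R" and p: "prime p"
    and k: "k \<in> H" "k - e \<in> multiples p R" and m: "k [^]\<^bsub>\<Gamma>\<^esub> m = e" "\<not> p dvd int m"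
  shows "k = e"
proof -
  interpret group \<Gamma> by (rule grp)
  have eH: "e \<in> H" using one_closed by (simp add: \<Gamma>_def)
  have e: "e ** h = h" "h ** e = h" if "h \<in> H" for h
    using that l_one[of h] r_one[of h] by (auto simp: \<Gamma>_def)
  define d where "d = k - e"
  have de: "d ** e = d"
    using e k(1) eH by (simp_all add: d_def matrix_mult_minus_distrib)
  have k_eq: "k = e + d" by (simp add: d_def)
  have dR: "d \<in> R" unfolding d_def using HR k(1) eH by (intro zmod.subspace_diff[OF R(1)]) auto
  have "d \<in> multiples (p ^ Suc a) R" for a
  proof (induction a)
    case 0
    show ?case using k(2) by (simp add: d_def)
  next
    case (Suc a)
    let ?M = "multiples (p ^ Suc (Suc a)) R"
    note M = subspace_multiples[OF R(1), of "p ^ Suc (Suc a)"]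
    have "d ** d \<in> multiples (p ^ Suc a * p ^ Suc a) R"
      using multiples_mult[OF R(2) Suc Suc] by blast
    moreover have "p ^ Suc (Suc a) dvd p ^ Suc a * p ^ Suc a"
      by (simp add: mult.commute)
    ultimately have dd: "d ** d \<in> ?M" using multiples_mono[OF R(1)] by blast
    have "k [^]\<^bsub>\<Gamma>\<^esub> j - e - of_int (int j) * d \<in> ?M" for j :: nat
    proof (induction j)
      case 0
      show ?case using zmod.subspace_0[OF M] by (simp add: \<Gamma>_def)
    next
      case (Suc j)
      define y where "y = k [^]\<^bsub>\<Gamma>\<^esub> j - e - of_int (int j) * d"
      have kj: "k [^]\<^bsub>\<Gamma>\<^esub> j = e + of_int (int j) * d + y" by (simp add: y_def)
      have "y ** k \<in> multiples (p ^ Suc (Suc a) * 1) R"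
        using Suc k(1) HR unfolding y_def
        by (intro multiples_mult[OF R(2)]) (auto simp: multiples_one)
      then have yk: "y ** k \<in> ?M" by simp
      have "k [^]\<^bsub>\<Gamma>\<^esub> Suc j = (e + of_int (int j) * d + y) ** k"
        unfolding kj[symmetric] by (simp add: \<Gamma>_def)
      also have "\<dots> = e ** k + of_int (int j) * (d ** k) + y ** k"
        by (simp only: matrix_add_rdistrib matrix_mult_of_int)
      also have "e ** k = e + d" using e(1)[OF k(1)] by (simp add: d_def)
      also have "d ** k = d + d ** d" by (simp add: k_eq matrix_add_ldistrib de)
      finally have "k [^]\<^bsub>\<Gamma>\<^esub> Suc j - e - of_int (int (Suc j)) * d
          = of_int (int j) * (d ** d) + y ** k"
        by (simp add: algebra_simps)
      moreover have "of_int (int j) * (d ** d) + y ** k \<in> ?M"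
        by (rule zmod.subspace_add[OF M zmod.subspace_scale[OF M dd] yk])
      ultimately show ?case by simp
    qed
    from this[of m] have "- (of_int (int m) * d) \<in> ?M" by (simp add: m(1))
    then have md: "of_int (int m) * d \<in> ?M" using zmod.subspace_neg[OF M] by fastforce
    have "coprime (int m) p" using m(2) p by (simp add: coprime_commute prime_imp_coprime)
    then obtain v w where vw: "v * int m + w * p = 1"
      using bezout_int[of "int m" p] by auto
    obtain r where r: "r \<in> R" "d = of_int (p ^ Suc a) * r" using Suc by (auto simp: multiples_def)
    have "of_int p * d = of_int (p ^ Suc (Suc a)) * r" by (simp add: r(2) mult.assoc)
    then have pd: "of_int p * d \<in> ?M" using r(1) by (auto simp: multiples_def)
    have "d = of_int (v * int m + w * p) * d" by (simp only: vw of_int_1 mult_1)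
    also have "\<dots> = of_int v * (of_int (int m) * d) + of_int w * (of_int p * d)"
      by (simp add: distrib_right mult.assoc)
    also have "\<dots> \<in> ?M"
      by (rule zmod.subspace_add[OF M zmod.subspace_scale[OF M md] zmod.subspace_scale[OF M pd]])
    finally show ?case .
  qed
  then have "d \<in> multiples (p ^ a) R" for a
    by (cases a) (use dR in \<open>auto simp: multiples_one\<close>)
  then show ?thesis using sep[of d] by (simp add: d_def)
qed

text \<open>
  The part of Minkowski's argument for \<open>p = 3\<close> and order three: with \<open>d = k - e\<close> the equation
  \<open>k\<^sup>3 = e\<close> reads \<open>3d = - 3d\<^sup>2 - d\<^sup>3\<close>. If \<open>3\<^sup>a\<close> divides \<open>d\<close> and \<open>a \<ge> 1\<close>, then the right hand side
  is divisible by \<open>3\<^sup>a\<^sup>+\<^sup>2\<close>, since \<open>1 + 2a\<close> and \<open>3a\<close> are both at least \<open>a + 2\<close>. The second inequality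
  has the analogue \<open>2a \<ge> a + 2\<close> for the prime 2, which fails for \<open>a = 1\<close>: the sign matrix \<open>- 1\<close> is
  congruent to \<open>1\<close> modulo 2.
\<close>

lemma congruent_one_cube:
  fixes R :: "(rat ^ 'n ^ 'n) set"
  assumes R: "zmod.subspace R" "\<And>a b. a \<in> R \<Longrightarrow> b \<in> R \<Longrightarrow> a ** b \<in> R"
    and sep: "\<And>x. (\<And>a. x \<in> multiples (3 ^ a) R) \<Longrightarrow> x = 0"
    and e: "e ** e = e" "e ** k = k" "k ** e = k"
    and k: "k - e \<in> multiples 3 R" "k ** k ** k = e"
  shows "k = e"
proof -
  define d where "d = k - e"
  have de: "d ** e = d" and ed: "e ** d = d"
    using e by (simp_all add: d_def matrix_mult_minus_distrib)
  have k_eq: "k = e + d" by (simp add: d_def)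
  have dde: "d ** d ** e = d ** d" by (simp add: de flip: matrix_mul_assoc)
  have "k ** k ** k = e + (d + d + d) + (d ** d + d ** d + d ** d) + d ** d ** d"
    by (simp only: k_eq matrix_add_ldistrib matrix_add_rdistrib e(1) de ed dde add_ac)
  also have "\<dots> = e + of_int 3 * d + of_int 3 * (d ** d) + d ** d ** d"
    by (simp add: algebra_simps)
  finally have cube: "of_int 3 * d + of_int 3 * (d ** d) + d ** d ** d = 0"
    using k(2) by (simp add: add.assoc)
  have "d \<in> multiples (3 ^ Suc a) R" for a
  proof (induction a)
    case 0
    show ?case using k(1) by (simp add: d_def)
  next
    case (Suc a)
    obtain r where r: "r \<in> R" "d = of_int (3 ^ Suc a) * r" using Suc by (auto simp: multiples_def)
    define y where "y = - (of_int (3 ^ a) * (r ** r) + of_int (9 ^ a) * (r ** r ** r))"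
    have yR: "y \<in> R"
      unfolding y_def using R r(1)
      by (intro zmod.subspace_neg zmod.subspace_add zmod.subspace_scale) auto
    have "of_int 3 * d = - (of_int 3 * (d ** d) + d ** d ** d)"
      using cube by (simp only: eq_neg_iff_add_eq_0 add.assoc)
    also have "\<dots> = of_int 3 * (of_int (3 ^ Suc (Suc a)) * y)"
    proof -
      have "of_int 3 * (d ** d) = of_int (3 * (3 ^ Suc a * 3 ^ Suc a)) * (r ** r)"
        by (simp only: r(2) matrix_mult_of_int of_int_mult mult.assoc)
      also have "(3::int) * (3 ^ Suc a * 3 ^ Suc a) = 3 * (3 ^ Suc (Suc a) * 3 ^ a)" by simp
      finally have sq: "of_int 3 * (d ** d) = of_int (3 * (3 ^ Suc (Suc a) * 3 ^ a)) * (r ** r)" .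
      have "d ** d ** d = of_int (3 ^ Suc a * (3 ^ Suc a * 3 ^ Suc a)) * (r ** r ** r)"
        by (simp only: r(2) matrix_mult_of_int of_int_mult mult.assoc)
      also have "(3::int) ^ Suc a * (3 ^ Suc a * 3 ^ Suc a) = 3 * (3 ^ Suc (Suc a) * 9 ^ a)"
        by (simp flip: power_mult_distrib)
      finally have cb: "d ** d ** d = of_int (3 * (3 ^ Suc (Suc a) * 9 ^ a)) * (r ** r ** r)" .
      show ?thesis
        unfolding y_def sq cb
        by (simp only: mult_minus_right distrib_left of_int_mult mult.assoc)
    qed
    finally have "d = of_int (3 ^ Suc (Suc a)) * y" by (rule matrix_of_int_cancel) simp
    then show ?case using yR by (auto simp: multiples_def)
  qed
  moreover have "multiples 3 R \<subseteq> R" using R(1) by (rule multiples_subset)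
  ultimately have "d \<in> multiples (3 ^ a) R" for a
    by (cases a) (use k(1) in \<open>auto simp: multiples_one d_def\<close>)
  then show ?thesis using sep[of d] by (simp add: d_def)
qed

text \<open>
  Removing a factor 3 from the exponent replaces \<open>k\<close> by \<open>k\<^sup>3\<close>, which is still congruent to \<open>e\<close>;
  once \<open>k\<^sup>3 = e\<close> is known, the case of order three applies.
\<close>

lemma congruent_one_mod_3:
  fixes H R :: "(rat ^ 'n ^ 'n) set" and e and m :: nat
  defines "\<Gamma> \<equiv> \<lparr>carrier = H, mult = (**), one = e\<rparr>"
  assumes grp: "group \<Gamma>" and R: "zmod.subspace R" "\<And>a b. a \<in> R \<Longrightarrow> b \<in> R \<Longrightarrow> a ** b \<in> R"
    and sep: "\<And>x. (\<And>a. x \<in> multiples (3 ^ a) R) \<Longrightarrow> x = 0"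
    and HR: "H \<subseteq> R"
  shows "k \<in> H \<Longrightarrow> k - e \<in> multiples 3 R \<Longrightarrow> k [^]\<^bsub>\<Gamma>\<^esub> m = e \<Longrightarrow> m > 0 \<Longrightarrow> k = e"
proof (induction m arbitrary: k rule: less_induct)
  case (less m)
  interpret group \<Gamma> by (rule grp)
  have eH: "e \<in> H" using one_closed by (simp add: \<Gamma>_def)
  have e: "e ** h = h" "h ** e = h" if "h \<in> H" for h
    using that l_one[of h] r_one[of h] by (auto simp: \<Gamma>_def)
  show ?case
  proof (cases "3 dvd m")
    case False
    then have "\<not> (3::int) dvd int m" by presburger
    then show ?thesis
      by (intro congruent_one_coprime_order[OF grp[unfolded \<Gamma>_def] R sep HR _ less.prems(1,2)
            less.prems(3)[unfolded \<Gamma>_def]]) auto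
  next
    case True
    then obtain l where l: "m = 3 * l" by blast
    let ?k3 = "k [^]\<^bsub>\<Gamma>\<^esub> (3::nat)"
    have kc: "k \<in> carrier \<Gamma>" using less.prems(1) by (simp add: \<Gamma>_def)
    have k3: "?k3 = k ** k ** k"
      using e(1)[OF less.prems(1)] by (simp add: numeral_3_eq_3 \<Gamma>_def)
    have "?k3 \<in> H" using nat_pow_closed[OF kc] by (simp add: \<Gamma>_def)
    moreover have "?k3 - e \<in> multiples 3 R"
    proof -
      have "?k3 - e = (k - e) ** k ** k + (k - e) ** k + (k - e)"
        using e less.prems(1) by (simp add: k3 matrix_mult_minus_distrib)
      moreover have "(k - e) ** k \<in> multiples (3 * 1) R" "(k - e) ** k ** k \<in> multiples (3 * 1 * 1) R"
        using less.prems(1,2) HR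
        by (intro multiples_mult[OF R(2)]; auto simp: multiples_one)+
      ultimately show ?thesis
        using less.prems(2) by (simp only: zmod.subspace_add[OF subspace_multiples[OF R(1)]] mult_1_right)
    qed
    moreover have "?k3 [^]\<^bsub>\<Gamma>\<^esub> l = e"
      using less.prems(3) nat_pow_pow[OF kc] by (simp add: l)
    ultimately have "?k3 = e" using less.IH[of l ?k3] less.prems(4) l by simp
    then show ?thesis
      using congruent_one_cube[OF R sep] e eH less.prems(1,2) by (simp add: k3)
  qed
qed

section \<open>Idempotents of minimal rank\<close>

text \<open>
  The rank is taken as the dimension of the range, because equality of ranks is used to conclude
  that a range contained in another one is equal to it.
\<close>

definition mrank :: "'a::field ^ 'n ^ 'm \<Rightarrow> nat" where
  "mrank A = vec.dim (range ((*v) A))"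

lemma subspace_range_matrix: "vec.subspace (range ((*v) (A :: 'a::field ^ 'n ^ 'm)))"
  using vec.subspace_UNIV by (intro vec.subspace_image matrix_vector_mul_linear_gen)

lemma range_matrix_mult: "range ((*v) (A ** B)) = (*v) A ` range ((*v) B)"
  for A :: "'a::field ^ 'n ^ 'm" and B :: "'a ^ 'k ^ 'n"
  by (auto simp: image_image matrix_vector_mul_assoc)

lemma range_matrix_mult_subset: "range ((*v) (A ** B)) \<subseteq> range ((*v) A)"
  for A :: "'a::field ^ 'n ^ 'm" and B :: "'a ^ 'k ^ 'n"
  unfolding range_matrix_mult by blast

lemma mrank_mult_le: "mrank (A ** B) \<le> mrank A" "mrank (A ** B) \<le> mrank B"
  for A :: "'a::field ^ 'n ^ 'm" and B :: "'a ^ 'k ^ 'n"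
proof -
  show "mrank (A ** B) \<le> mrank A"
    unfolding mrank_def by (intro vec.dim_subset range_matrix_mult_subset)
  show "mrank (A ** B) \<le> mrank B"
    unfolding mrank_def range_matrix_mult by (intro vec.dim_image_le matrix_vector_mul_linear_gen)
qed

lemma range_mult_eq_of_mrank_eq:
  fixes A :: "'a::field ^ 'n ^ 'm" and B :: "'a ^ 'k ^ 'n"
  assumes "mrank A \<le> mrank (A ** B)"
  shows "range ((*v) (A ** B)) = range ((*v) A)"
  using assms unfolding mrank_def
  by (intro vec.subspace_dim_equal subspace_range_matrix range_matrix_mult_subset)

lemma mrank_eq_0_iff: "mrank A = 0 \<longleftrightarrow> A = 0" for A :: "'a::field ^ 'n ^ 'm"
proof
  assume "mrank A = 0"
  then have "range ((*v) A) \<subseteq> {0}" unfolding mrank_def by simp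
  then have "\<forall>x. A *v x = 0 *v x" by auto
  then show "A = 0" using matrix_eq by blast
qed (simp add: mrank_def)

text \<open>
  A product \<open>A ** C\<close> depends on \<open>A\<close> only through its action on the range of \<open>C\<close>. This turns
  statements about ranges into cancellation laws.
\<close>

lemma mult_eq_on_range:
  fixes A B :: "'a::field ^ 'n ^ 'm" and C :: "'a ^ 'k ^ 'n" and D :: "'a ^ 'l ^ 'n"
  assumes "A ** C = B ** C" "range ((*v) D) \<subseteq> range ((*v) C)"
  shows "A ** D = B ** D"
proof -
  have "A *v (D *v x) = B *v (D *v x)" for x
  proof -
    obtain y where "D *v x = C *v y" using assms(2) by blast
    then show ?thesis using assms(1) by (simp add: matrix_vector_mul_assoc)
  qed
  then show ?thesis by (simp add: matrix_eq matrix_vector_mul_assoc)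
qed

text \<open>
  Since \<open>h\<close> and \<open>h\<^sup>2\<close> have the same range, right multiplication by \<open>h\<close> is injective on the finite
  set \<open>X = Sh \<union> {h}\<close>, hence surjective, and \<open>h = eh\<close> for some \<open>e\<close> in \<open>X\<close>. This \<open>e\<close> fixes
  the range of \<open>h\<close> pointwise, and its rank is at most that of \<open>h\<close>.
\<close>

lemma idempotent_with_same_range:
  fixes S :: "(rat ^ 'n ^ 'n) set"
  assumes S: "\<And>a b. a \<in> S \<Longrightarrow> b \<in> S \<Longrightarrow> a ** b \<in> S" "finite S"
    and h: "h \<in> S" "mrank h \<le> mrank (h ** h)"
  shows "\<exists>e\<in>S. e ** e = e \<and> range ((*v) e) = range ((*v) h)"
proof -
  define X where "X = insert h ((\<lambda>s. s ** h) ` S)"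
  have XS: "X \<subseteq> S" using S h by (auto simp: X_def)
  have X: "\<exists>a. x = a ** h" if "x \<in> X" for x
    using that unfolding X_def by (auto intro: exI[of _ "mat 1"])
  have hh: "range ((*v) (h ** h)) = range ((*v) h)" using h(2) by (rule range_mult_eq_of_mrank_eq)
  have "inj_on (\<lambda>x. x ** h) X"
  proof (rule inj_onI)
    fix x y assume "x \<in> X" "y \<in> X" and eq: "x ** h = y ** h"
    then obtain a b where ab: "x = a ** h" "y = b ** h" using X by meson
    have "a ** (h ** h) = b ** (h ** h)" using eq by (simp add: ab matrix_mul_assoc)
    then have "a ** h = b ** h" by (rule mult_eq_on_range) (simp add: hh)
    then show "x = y" by (simp add: ab)
  qed
  moreover have "(\<lambda>x. x ** h) ` X \<subseteq> X" using XS by (auto simp: X_def)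
  moreover have "finite X" using XS S(2) by (rule finite_subset)
  ultimately have "(\<lambda>x. x ** h) ` X = X" by (simp add: endo_inj_surj)
  then obtain e where e: "e \<in> X" "e ** h = h" unfolding X_def by (metis imageE insertI1)
  obtain a where a: "e = a ** h" using X e(1) by blast
  have "range ((*v) h) \<subseteq> range ((*v) e)" using range_matrix_mult_subset[of e h] by (simp add: e(2))
  moreover have "mrank e \<le> mrank h" unfolding a by (rule mrank_mult_le)
  ultimately have re: "range ((*v) e) = range ((*v) h)"
    unfolding mrank_def by (metis vec.subspace_dim_equal subspace_range_matrix)
  have "e ** h = mat 1 ** h" by (simp add: e(2))
  then have "e ** e = mat 1 ** e" by (rule mult_eq_on_range) (simp add: re)
  then show ?thesis using e(1) XS re by auto
qed

text \<open>
  The nonzero part of the corner \<open>eSe\<close>. It is a group when \<open>e\<close> is an idempotent for which the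
  nonzero elements of \<open>eSe\<close> have the rank of \<open>e\<close>, the property recorded next. Demanding this of
  \<open>eSe\<close> only, and not that \<open>e\<close> has minimal nonzero rank in \<open>S\<close>, makes it apply at once to every
  nonzero idempotent of a minimal ideal.
\<close>

definition local_group :: "(rat ^ 'n ^ 'n) set \<Rightarrow> rat ^ 'n ^ 'n \<Rightarrow> (rat ^ 'n ^ 'n) set" where
  "local_group S e = (\<lambda>s. e ** s ** e) ` S - {0}"

definition rank_minimal_idempotent :: "(rat ^ 'n ^ 'n) set \<Rightarrow> rat ^ 'n ^ 'n \<Rightarrow> bool" where
  "rank_minimal_idempotent S e \<longleftrightarrow> e \<in> S \<and> e ** e = e \<and> e \<noteq> 0 \<and>
     (\<forall>s\<in>S. e ** s ** e \<noteq> 0 \<longrightarrow> mrank (e ** s ** e) = mrank e)"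

lemma local_group_subset:
  assumes "\<And>a b. a \<in> S \<Longrightarrow> b \<in> S \<Longrightarrow> a ** b \<in> S" "e \<in> S"
  shows "local_group S e \<subseteq> S"
  using assms by (auto simp: local_group_def)

lemma local_group_unit:
  assumes "g \<in> local_group S e" "e ** e = e"
  shows "e ** g = g" "g ** e = g"
  using assms by (auto simp: local_group_def matrix_mul_assoc) (metis matrix_mul_assoc)+

lemma local_groupI:
  assumes "s \<in> S" "e ** s = s" "s ** e = s" "s \<noteq> 0"
  shows "s \<in> local_group S e"
  using assms unfolding local_group_def by (metis DiffI image_eqI singletonD)

text \<open>
  All nonzero elements of the corner act bijectively on the range of \<open>e\<close>. So products do not vanish, and
  right multiplication by an element \<open>g\<close> is injective on the finite set of nonzero elements; its
  image contains \<open>e\<close>, and a preimage of \<open>e\<close> is a left inverse of \<open>g\<close>.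
\<close>

lemma group_local_group:
  fixes S :: "(rat ^ 'n ^ 'n) set"
  assumes S: "\<And>a b. a \<in> S \<Longrightarrow> b \<in> S \<Longrightarrow> a ** b \<in> S" "finite S"
    and e: "rank_minimal_idempotent S e"
  shows "group \<lparr>carrier = local_group S e, mult = (**), one = e\<rparr>"
proof -
  let ?H = "local_group S e"
  have eS: "e \<in> S" and ee: "e ** e = e" and e0: "e \<noteq> 0"
    using e by (auto simp: rank_minimal_idempotent_def)
  note HS = local_group_subset[OF S(1) eS]
  note unit = local_group_unit[OF _ ee]
  have range: "range ((*v) g) = range ((*v) e)" if g: "g \<in> ?H" for g
  proof -
    have "mrank g = mrank e"
      using g e by (auto simp: local_group_def rank_minimal_idempotent_def)
    then have "range ((*v) (e ** g)) = range ((*v) e)"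
      using unit(1)[OF g] by (intro range_mult_eq_of_mrank_eq) simp
    then show ?thesis using unit(1)[OF g] by simp
  qed
  have closed: "x ** y \<in> ?H" if x: "x \<in> ?H" and y: "y \<in> ?H" for x y
  proof (rule local_groupI)
    show "x ** y \<in> S" using HS x y S(1) by blast
    show "e ** (x ** y) = x ** y" using unit(1)[OF x] by (simp add: matrix_mul_assoc)
    show "x ** y ** e = x ** y" using unit(2)[OF y] by (simp flip: matrix_mul_assoc)
    have "range ((*v) (x ** y)) = range ((*v) (x ** e))"
      unfolding range_matrix_mult by (simp add: range[OF y])
    also have "\<dots> = range ((*v) e)" using range[OF x] unit(2)[OF x] by simp
    finally have "mrank (x ** y) = mrank e" by (simp add: mrank_def)
    then show "x ** y \<noteq> 0" using e0 by (metis mrank_eq_0_iff)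
  qed
  have one: "e \<in> ?H" using eS ee e0 by (intro local_groupI)
  have inv: "\<exists>x\<in>?H. x ** g = e" if g: "g \<in> ?H" for g
  proof -
    have "inj_on (\<lambda>x. x ** g) ?H"
    proof (rule inj_onI)
      fix x y assume xy: "x \<in> ?H" "y \<in> ?H" "x ** g = y ** g"
      have "x ** e = y ** e" using xy(3) by (rule mult_eq_on_range) (simp add: range[OF g])
      then show "x = y" using unit(2) xy(1,2) by simp
    qed
    moreover have "(\<lambda>x. x ** g) ` ?H \<subseteq> ?H" using closed g by blast
    moreover have "finite ?H" using HS S(2) by (rule finite_subset)
    ultimately have "(\<lambda>x. x ** g) ` ?H = ?H" by (simp add: endo_inj_surj)
    then show ?thesis using one by (metis imageE)
  qed
  show ?thesis
    by (rule groupI) (use closed one unit inv in \<open>auto simp: matrix_mul_assoc\<close>)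
qed

section \<open>Irreducibility\<close>

lemma subspace_kernel_matrix: "vec.subspace {y. A *v y = 0}" for A :: "'a::field ^ 'n ^ 'm"
  by (auto simp: vec.subspace_def matrix_vector_right_distrib vec.scale
      intro: vec.linear_scale[OF matrix_vector_mul_linear_gen, THEN trans])

text \<open>
  The vectors \<open>y\<close> with \<open>aSy = 0\<close> form an invariant subspace, which is proper because \<open>aS \<noteq> 0\<close>.
\<close>

lemma irreducible_kernel_trivial:
  fixes S :: "(rat ^ 'n ^ 'n) set"
  assumes S: "\<And>a b. a \<in> S \<Longrightarrow> b \<in> S \<Longrightarrow> a ** b \<in> S" and irr: "matrix_irreducible S"
    and nz: "s\<^sub>0 \<in> S" "a ** s\<^sub>0 \<noteq> 0"
    and y: "\<And>s. s \<in> S \<Longrightarrow> a *v (s *v y) = 0"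
  shows "y = 0"
proof -
  define W where "W = (\<Inter>s\<in>S. {y. (a ** s) *v y = 0})"
  have "vec.subspace W" unfolding W_def by (intro vec.subspace_Inter) (auto intro: subspace_kernel_matrix)
  moreover have "\<forall>t\<in>S. (\<lambda>x. t *v x) ` W \<subseteq> W"
    using S by (auto simp: W_def matrix_vector_mul_assoc simp flip: matrix_mul_assoc)
  moreover have "W \<noteq> UNIV"
  proof
    assume "W = UNIV"
    then have "\<forall>x. (a ** s\<^sub>0) *v x = 0 *v x" using nz(1) by (auto simp: W_def)
    then show False using nz(2) matrix_eq by blast
  qed
  ultimately have "W = {0}" using irr by (auto simp: matrix_irreducible_def)
  then show ?thesis using y by (auto simp: W_def matrix_vector_mul_assoc)
qed

text \<open>
  Dually, the columns of the matrices in \<open>Sa\<close> span a nonzero invariant subspace, hence everything,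
  and \<open>d\<close> vanishes on it.
\<close>

lemma irreducible_orbit_spans:
  fixes S :: "(rat ^ 'n ^ 'n) set"
  assumes S: "\<And>a b. a \<in> S \<Longrightarrow> b \<in> S \<Longrightarrow> a ** b \<in> S" and irr: "matrix_irreducible S"
    and nz: "s\<^sub>0 \<in> S" "s\<^sub>0 ** a \<noteq> 0"
    and d: "\<And>s. s \<in> S \<Longrightarrow> d ** s ** a = 0"
  shows "d = 0"
proof -
  define U where "U = (\<Union>s\<in>S. range ((*v) (s ** a)))"
  have "(\<lambda>x. t *v x) ` vec.span U \<subseteq> vec.span U" if t: "t \<in> S" for t
  proof -
    have "(\<lambda>x. t *v x) ` vec.span U = vec.span ((*v) t ` U)"
      by (simp add: vec.linear_span_image)
    also have "\<dots> \<subseteq> vec.span U"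
    proof (rule vec.span_mono, rule image_subsetI)
      fix w assume "w \<in> U"
      then obtain s x where "s \<in> S" "w = (s ** a) *v x" by (auto simp: U_def)
      then have "t ** s \<in> S" "t *v w = (t ** s ** a) *v x"
        using S t by (auto simp: matrix_vector_mul_assoc matrix_mul_assoc)
      then show "t *v w \<in> U" by (auto simp: U_def)
    qed
    finally show ?thesis .
  qed
  moreover have "vec.span U \<noteq> {0}"
  proof
    assume "vec.span U = {0}"
    then have "U \<subseteq> {0}" using vec.span_superset by blast
    then have "\<forall>x. (s\<^sub>0 ** a) *v x = 0 *v x" using nz(1) by (auto simp: U_def)
    then show False using nz(2) matrix_eq by blast
  qed
  ultimately have "vec.span U = UNIV" using irr unfolding matrix_irreducible_def by blast
  moreover have "vec.span U \<subseteq> {y. d *v y = 0}"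
  proof (rule vec.span_minimal[OF _ subspace_kernel_matrix])
    show "U \<subseteq> {y. d *v y = 0}"
      using d by (auto simp: U_def matrix_vector_mul_assoc matrix_mul_assoc)
  qed
  ultimately have "\<forall>x. d *v x = 0 *v x" by auto
  then show ?thesis using matrix_eq by blast
qed

text \<open>
  Distinct elements of an irreducible semigroup are told apart by their compressions to the corner
  \<open>eSe\<close>. This reduces counting \<open>S\<close> to a question about the local group.
\<close>

lemma irreducible_compression_separates:
  fixes S :: "(rat ^ 'n ^ 'n) set"
  assumes S: "\<And>a b. a \<in> S \<Longrightarrow> b \<in> S \<Longrightarrow> a ** b \<in> S" and irr: "matrix_irreducible S"
    and e: "e \<in> S" "e ** e = e" "e \<noteq> 0"
    and eq: "\<And>u v. u \<in> S \<Longrightarrow> v \<in> S \<Longrightarrow> e ** u ** s ** v ** e = e ** u ** t ** v ** e"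
  shows "s = t"
proof -
  have ee: "e ** e \<noteq> 0" using e by simp
  have "(s - t) ** v ** e = 0" if v: "v \<in> S" for v
  proof -
    have "((s - t) ** v ** e) *v x = 0" for x
    proof (rule irreducible_kernel_trivial[OF S irr e(1) ee])
      fix u assume u: "u \<in> S"
      have "e *v (u *v (((s - t) ** v ** e) *v x)) = (e ** u ** (s - t) ** v ** e) *v x"
        by (simp add: matrix_vector_mul_assoc matrix_mul_assoc)
      also have "e ** u ** (s - t) ** v ** e = 0"
        using eq[OF u v] by (simp add: matrix_mult_minus_distrib)
      finally show "e *v (u *v (((s - t) ** v ** e) *v x)) = 0" by simp
    qed
    then have "\<forall>x. ((s - t) ** v ** e) *v x = 0 *v x" by simp
    then show ?thesis using matrix_eq by blast
  qed
  then have "s - t = 0" using irreducible_orbit_spans[OF S irr e(1) ee, of "s - t"] by blast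
  then show ?thesis by simp
qed

text \<open>
  Take \<open>x\<close> of minimal nonzero rank. Irreducibility yields \<open>s\<close> with \<open>xsx \<noteq> 0\<close>; by minimality \<open>xsx\<close>
  has the range of \<open>x\<close>, so \<open>h = xs\<close> maps the range of \<open>x\<close> onto itself, and there is an idempotent
  with the range of \<open>h\<close>.
\<close>

lemma ex_rank_minimal_idempotent:
  fixes S :: "(rat ^ 'n ^ 'n) set"
  assumes S: "\<And>a b. a \<in> S \<Longrightarrow> b \<in> S \<Longrightarrow> a ** b \<in> S" "finite S" "S \<noteq> {}" "S \<noteq> {0}"
    and irr: "matrix_irreducible S"
  shows "\<exists>e. rank_minimal_idempotent S e"
proof -
  obtain s\<^sub>1 where "s\<^sub>1 \<in> S" "s\<^sub>1 \<noteq> 0" using S(3,4) by blast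
  then have "\<exists>x. (x \<in> S \<and> x \<noteq> 0) \<and> (\<forall>y. y \<in> S \<and> y \<noteq> 0 \<longrightarrow> mrank x \<le> mrank y)"
    by (intro ex_has_least_nat[of "\<lambda>x. x \<in> S \<and> x \<noteq> 0" s\<^sub>1 mrank]) simp
  then obtain x where x: "x \<in> S" "x \<noteq> 0"
    and least: "\<And>y. y \<in> S \<Longrightarrow> y \<noteq> 0 \<Longrightarrow> mrank x \<le> mrank y"
    by blast
  \<comment> \<open>If \<open>xSx = 0\<close>, then \<open>xS = 0\<close>, and the kernel of \<open>x\<close> is a nonzero proper invariant subspace.\<close>
  have "\<exists>s\<in>S. x ** s ** x \<noteq> 0"
  proof (rule ccontr)
    assume "\<not> ?thesis"
    then have xsx: "\<And>s. s \<in> S \<Longrightarrow> x ** s ** x = 0" by blast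
    have xs: "x ** s = 0" if s: "s \<in> S" for s
    proof (rule ccontr)
      assume "x ** s \<noteq> 0"
      have "x *v y = 0" for y
        by (rule irreducible_kernel_trivial[OF S(1) irr s \<open>x ** s \<noteq> 0\<close>])
          (auto simp: matrix_vector_mul_assoc matrix_mul_assoc xsx)
      then have "\<forall>y. x *v y = 0 *v y" by simp
      then show False using x(2) matrix_eq by blast
    qed
    have "{y. x *v y = 0} = {0} \<or> {y. x *v y = 0} = UNIV"
      using irr xs subspace_kernel_matrix[of x]
      unfolding matrix_irreducible_def by (auto simp: matrix_vector_mul_assoc image_subset_iff)
    then show False
    proof
      assume ker: "{y. x *v y = 0} = {0}"
      have "x *v (x *v y) = 0" for y using xs[OF x(1)] by (simp add: matrix_vector_mul_assoc)
      then have "\<forall>y. x *v y = 0 *v y" using ker by auto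
      then show False using x(2) matrix_eq by blast
    next
      assume "{y. x *v y = 0} = UNIV"
      then have "\<forall>y. x *v y = 0 *v y" by auto
      then show False using x(2) matrix_eq by blast
    qed
  qed
  then obtain s where s: "s \<in> S" "x ** s ** x \<noteq> 0" by blast
  define h where "h = x ** s"
  have hS: "h \<in> S" using S(1) x s by (simp add: h_def)
  have hx: "range ((*v) (h ** x)) = range ((*v) x)"
  proof -
    have "mrank x \<le> mrank (x ** (s ** x))"
      using S(1) x s by (intro least) (auto simp: matrix_mul_assoc)
    then show ?thesis
      using range_mult_eq_of_mrank_eq[of x "s ** x"] by (simp add: h_def matrix_mul_assoc)
  qed
  have "mrank h \<le> mrank x" unfolding h_def by (rule mrank_mult_le)
  also have "mrank x = mrank (h ** (h ** x))"
    using hx by (simp add: mrank_def range_matrix_mult)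
  also have "\<dots> \<le> mrank (h ** h)" using mrank_mult_le(1)[of "h ** h" x] by (simp add: matrix_mul_assoc)
  finally obtain e where e: "e \<in> S" "e ** e = e" "range ((*v) e) = range ((*v) h)"
    using idempotent_with_same_range[OF S(1,2) hS] by blast
  have "mrank e \<le> mrank x"
    using mrank_mult_le(1)[of x s] e(3) by (simp add: mrank_def h_def)
  moreover have "e \<noteq> 0"
    using e(3) s(2) by (metis h_def mrank_def mrank_eq_0_iff times0_left)
  moreover have "mrank (e ** t ** e) = mrank e" if t: "t \<in> S" "e ** t ** e \<noteq> 0" for t
  proof (rule antisym)
    show "mrank (e ** t ** e) \<le> mrank e" by (rule mrank_mult_le)
    have "mrank x \<le> mrank (e ** t ** e)" using t e(1) S(1) by (intro least) auto
    then show "mrank e \<le> mrank (e ** t ** e)" using \<open>mrank e \<le> mrank x\<close> by simp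
  qed
  ultimately have "rank_minimal_idempotent S e"
    using e(1,2) by (simp add: rank_minimal_idempotent_def)
  then show ?thesis by blast
qed

section \<open>Bounding the semigroup by its local group\<close>

text \<open>
  If the local group meets the congruence class of its identity modulo \<open>p\<close> in the identity only,
  then any two distinct elements of \<open>eSe\<close>, zero included, are incongruent. By separation the same
  holds for \<open>S\<close>, because congruence modulo \<open>p\<close> is preserved by multiplication with elements of \<open>S\<close>.
\<close>

lemma card_le_of_trivial_congruence_kernel:
  fixes S :: "(rat ^ 'n ^ 'n) set" and p :: int
  assumes S: "\<And>a b. a \<in> S \<Longrightarrow> b \<in> S \<Longrightarrow> a ** b \<in> S" "finite S"
    and irr: "matrix_irreducible S" and e: "rank_minimal_idempotent S e" and p: "prime p"
    and ker: "\<And>k. k \<in> local_group S e \<Longrightarrow> k - e \<in> multiples p (zmod.span S) \<Longrightarrow> k = e"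
  shows "card S \<le> nat p ^ (CARD('n))\<^sup>2"
proof -
  let ?R = "zmod.span S" and ?H = "local_group S e"
  let ?M = "multiples p ?R"
  interpret H: group "\<lparr>carrier = ?H, mult = (**), one = e\<rparr>"
    using S e by (rule group_local_group)
  have eS: "e \<in> S" and ee: "e ** e = e" and e0: "e \<noteq> 0"
    using e by (auto simp: rank_minimal_idempotent_def)
  have R: "zmod.subspace ?R" by (rule zmod.subspace_span)
  have Rmult: "a ** b \<in> ?R" if "a \<in> ?R" "b \<in> ?R" for a b
    using S(1) that by (rule zmod_span_mult_closed)
  have SR: "S \<subseteq> ?R" by (rule zmod.span_superset)
  have p1: "p > 1" using p by (rule prime_gt_1_int)
  note M = subspace_multiples[OF R, of p]
  have M_left: "a ** x \<in> ?M" and M_right: "x ** a \<in> ?M" if "a \<in> S" "x \<in> ?M" for a x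
    using multiples_mult[of ?R a 1 x p] multiples_mult[of ?R x p a 1] Rmult that SR
    by (auto simp: multiples_one)
  have HS: "?H \<subseteq> S" using S(1) eS by (rule local_group_subset)
  have inv: "\<exists>h\<in>?H. h ** g = e" if "g \<in> ?H" for g
    using H.l_inv_ex[of g] that by simp
  have not_multiple: "g \<notin> ?M" if g: "g \<in> ?H" for g
  proof
    assume "g \<in> ?M"
    obtain h where "h \<in> ?H" "h ** g = e" using inv[OF g] by blast
    then have "e \<in> ?M" using M_left[of h g] HS \<open>g \<in> ?M\<close> by auto
    then have "e = 0"
      using idempotent_not_multiple[of ?R p e] Rmult zmod_span_separated[OF S(2) p1] ee
        multiples_subset[OF R] by blast
    then show False using e0 by simp
  qed
  have local_inj: "g = h" if g: "g \<in> ?H \<union> {0}" and h: "h \<in> ?H \<union> {0}" and gh: "g - h \<in> ?M" for g h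
  proof -
    have "h - g \<in> ?M" using zmod.subspace_neg[OF M gh] by simp
    then consider "g = 0" "h = 0" | "g \<in> ?H" "h \<in> ?H"
      using not_multiple g h gh by fastforce
    then show ?thesis
    proof cases
      case 2
      obtain h' where h': "h' \<in> ?H" "h' ** h = e" using inv[OF 2(2)] by blast
      have "h' ** g - e = h' ** (g - h)" by (simp add: matrix_mult_minus_distrib h'(2))
      then have "h' ** g - e \<in> ?M" using M_left[of h' "g - h"] HS h'(1) gh by auto
      moreover have "h' ** g \<in> ?H" using H.m_closed[of h' g] h'(1) 2(1) by simp
      ultimately have "h' ** g = h' ** h" using ker h'(2) by simp
      then show ?thesis using H.Units_l_cancel[of h' g h] h'(1) 2 H.Units_eq by simp
    qed simp
  qed
  have "card S \<le> nat p ^ (CARD('n) * CARD('n))"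
  proof (rule card_le_of_incongruent_matrices[OF R S(2) SR p])
    fix s t assume s: "s \<in> S" and t: "t \<in> S" and st: "s - t \<in> ?M"
    show "s = t"
    proof (rule irreducible_compression_separates[OF S(1) irr eS ee e0])
      fix u v assume u: "u \<in> S" and v: "v \<in> S"
      have comp: "e ** u ** w ** v ** e \<in> ?H \<union> {0}" if "w \<in> S" for w
      proof -
        have "e ** (u ** w ** v) ** e \<in> ?H \<union> {0}"
          using S(1) u v that unfolding local_group_def by blast
        then show ?thesis by (simp add: matrix_mul_assoc)
      qed
      have "e ** u ** (s - t) ** v ** e \<in> ?M"
        using st u v eS S(1) by (intro M_left M_right) auto
      then have "e ** u ** s ** v ** e - e ** u ** t ** v ** e \<in> ?M"
        by (simp add: matrix_mult_minus_distrib)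
      then show "e ** u ** s ** v ** e = e ** u ** t ** v ** e"
        by (rule local_inj[OF comp[OF s] comp[OF t]])
    qed
  qed
  then show ?thesis by (simp add: power2_eq_square)
qed

lemma card_le_3_power:
  fixes S :: "(rat ^ 'n ^ 'n) set"
  assumes S: "\<And>a b. a \<in> S \<Longrightarrow> b \<in> S \<Longrightarrow> a ** b \<in> S" "finite S"
    and irr: "matrix_irreducible S" and e: "rank_minimal_idempotent S e"
  shows "card S \<le> 3 ^ (CARD('n))\<^sup>2"
proof -
  let ?H = "local_group S e" and ?R = "zmod.span S"
  let ?\<Gamma> = "\<lparr>carrier = ?H, mult = (**), one = e\<rparr>"
  have grp: "group ?\<Gamma>" using S e by (rule group_local_group)
  interpret H: group ?\<Gamma> by (rule grp)
  have HS: "?H \<subseteq> S" using S(1) e by (intro local_group_subset) (auto simp: rank_minimal_idempotent_def)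
  then have fin: "finite ?H" using S(2) by (rule finite_subset)
  have "card S \<le> nat 3 ^ (CARD('n))\<^sup>2"
  proof (rule card_le_of_trivial_congruence_kernel[OF S irr e])
    fix k assume k: "k \<in> ?H" "k - e \<in> multiples 3 ?R"
    have ord: "k [^]\<^bsub>?\<Gamma>\<^esub> order ?\<Gamma> = e" using H.pow_order_eq_1[of k] k(1) by simp
    have pos: "order ?\<Gamma> > 0" using H.order_gt_0_iff_finite fin by simp
    show "k = e"
    proof (rule congruent_one_mod_3[OF grp zmod.subspace_span _ _ _ k ord pos])
      show "a ** b \<in> ?R" if "a \<in> ?R" "b \<in> ?R" for a b
        using S(1) that by (rule zmod_span_mult_closed)
      show "x = 0" if "\<And>a. x \<in> multiples (3 ^ a) ?R" for x
        using S(2) _ that by (rule zmod_span_separated) simp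
      show "?H \<subseteq> ?R" using HS zmod.span_superset by blast
    qed
  qed simp_all
  then show ?thesis by simp
qed

lemma card_le_2_power:
  fixes S :: "(rat ^ 'n ^ 'n) set"
  assumes S: "\<And>a b. a \<in> S \<Longrightarrow> b \<in> S \<Longrightarrow> a ** b \<in> S" "finite S"
    and irr: "matrix_irreducible S" and e: "rank_minimal_idempotent S e"
    and odd: "odd (card (local_group S e))"
  shows "card S \<le> 2 ^ (CARD('n))\<^sup>2"
proof -
  let ?H = "local_group S e" and ?R = "zmod.span S"
  let ?\<Gamma> = "\<lparr>carrier = ?H, mult = (**), one = e\<rparr>"
  have grp: "group ?\<Gamma>" using S e by (rule group_local_group)
  interpret H: group ?\<Gamma> by (rule grp)
  have HS: "?H \<subseteq> S" using S(1) e by (intro local_group_subset) (auto simp: rank_minimal_idempotent_def)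
  have "card S \<le> nat 2 ^ (CARD('n))\<^sup>2"
  proof (rule card_le_of_trivial_congruence_kernel[OF S irr e])
    fix k assume k: "k \<in> ?H" "k - e \<in> multiples 2 ?R"
    have ord: "k [^]\<^bsub>?\<Gamma>\<^esub> card ?H = e"
      using H.pow_order_eq_1[of k] k(1) by (simp add: order_def)
    show "k = e"
    proof (rule congruent_one_coprime_order[OF grp zmod.subspace_span _ _ _ _ k ord])
      show "a ** b \<in> ?R" if "a \<in> ?R" "b \<in> ?R" for a b
        using S(1) that by (rule zmod_span_mult_closed)
      show "x = 0" if "\<And>a. x \<in> multiples (2 ^ a) ?R" for x
        using S(2) _ that by (rule zmod_span_separated) simp
      show "?H \<subseteq> ?R" using HS zmod.span_superset by blast
      show "\<not> 2 dvd int (card ?H)" using odd by simp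
    qed simp
  qed simp_all
  then show ?thesis by simp
qed

section \<open>Maximal subgroups and minimal ideals\<close>

lemma matrix_group_unit:
  assumes "matrix_group G"
  obtains e where "group \<lparr>carrier = G, mult = (**), one = e\<rparr>" "e \<in> G" "e ** e = e"
    "\<And>g. g \<in> G \<Longrightarrow> e ** g = g \<and> g ** e = g"
proof -
  obtain e where e: "group \<lparr>carrier = G, mult = (**), one = e\<rparr>"
    using assms by (auto simp: matrix_group_def)
  interpret group "\<lparr>carrier = G, mult = (**), one = e\<rparr>" by (rule e)
  show thesis by (rule that[OF e]) (use one_closed l_one r_one in auto)
qed

text \<open>
  An idempotent of a group is its identity, so \<open>G = eGe\<close>; and \<open>0 \<notin> G\<close> because \<open>e \<noteq> 0\<close>.
\<close>

lemma matrix_group_subset_local_group: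
  assumes "matrix_group G" "G \<subseteq> S" "e \<in> G" "e ** e = e" "e \<noteq> 0"
  shows "G \<subseteq> local_group S e"
proof
  fix g assume g: "g \<in> G"
  obtain f where f: "group \<lparr>carrier = G, mult = (**), one = f\<rparr>" "\<And>g. g \<in> G \<Longrightarrow> f ** g = g \<and> g ** f = g"
    using matrix_group_unit[OF assms(1)] by metis
  interpret group "\<lparr>carrier = G, mult = (**), one = f\<rparr>" by (rule f(1))
  have ef: "e = f" using l_cancel_one[of e e] assms(3,4) by simp
  obtain h where "h ** g = e" using l_inv_ex[of g] g ef by auto
  then have "g \<noteq> 0" using assms(5) by auto
  then show "g \<in> local_group S e" using f(2)[OF g] g assms(2) ef by (intro local_groupI) auto
qed

lemma maximal_subgroup_local_group:
  fixes S :: "(rat ^ 'n ^ 'n) set"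
  assumes S: "\<And>a b. a \<in> S \<Longrightarrow> b \<in> S \<Longrightarrow> a ** b \<in> S" "finite S"
    and e: "rank_minimal_idempotent S e"
  shows "maximal_subgroup S (local_group S e)"
  unfolding maximal_subgroup_def
proof (intro conjI allI impI)
  have e': "e \<in> S" "e ** e = e" "e \<noteq> 0" using e by (auto simp: rank_minimal_idempotent_def)
  then have eH: "e \<in> local_group S e" by (intro local_groupI)
  show "local_group S e \<subseteq> S" using S(1) e'(1) by (rule local_group_subset)
  show "matrix_group (local_group S e)"
    using group_local_group[OF S e] by (auto simp: matrix_group_def)
  fix K assume K: "K \<subseteq> S \<and> matrix_group K \<and> local_group S e \<subseteq> K"
  then show "K = local_group S e"
    using matrix_group_subset_local_group[of K S e] e'(2,3) eH by blast
qed

text \<open>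
  The elements of \<open>I\<close> of rank at most that of \<open>y\<close> form a nonzero ideal contained in \<open>I\<close>, hence
  equal to \<open>I\<close>.
\<close>

lemma minimal_ideal_constant_rank:
  fixes S :: "(rat ^ 'n ^ 'n) set"
  assumes I: "if 0 \<in> S then zero_minimal_ideal S I else minimal_ideal S I"
    and xy: "x \<in> I" "x \<noteq> 0" "y \<in> I" "y \<noteq> 0"
  shows "mrank x \<le> mrank y"
proof -
  have ideal: "matrix_ideal S I"
    using I by (auto simp: zero_minimal_ideal_def minimal_ideal_def split: if_splits)
  define J where "J = {z \<in> I. mrank z \<le> mrank y}"
  have yJ: "y \<in> J" using xy by (simp add: J_def)
  have "matrix_ideal S J"
    using ideal yJ mrank_mult_le unfolding matrix_ideal_def J_def by (blast intro: order_trans)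
  moreover have "J \<subseteq> I" by (auto simp: J_def)
  ultimately have "J = {0} \<or> J = I"
    using I by (auto simp: zero_minimal_ideal_def minimal_ideal_def split: if_splits)
  then have "J = I" using yJ xy(4) by blast
  then show ?thesis using xy(1) by (auto simp: J_def)
qed

text \<open>
  The identity \<open>e\<close> of \<open>G\<close> lies in \<open>I\<close>, and \<open>eSe \<subseteq> I\<close>. As the nonzero elements of \<open>I\<close> all have the
  same rank, the local group at \<open>e\<close> is a subgroup of \<open>I\<close> that contains \<open>G\<close>.
\<close>

lemma maximal_subgroup_of_minimal_ideal:
  fixes S :: "(rat ^ 'n ^ 'n) set"
  assumes S: "\<And>a b. a \<in> S \<Longrightarrow> b \<in> S \<Longrightarrow> a ** b \<in> S" "finite S"
    and I: "if 0 \<in> S then zero_minimal_ideal S I else minimal_ideal S I"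
    and G: "maximal_subgroup I G" "G \<subseteq> I - {0}"
  obtains e where "rank_minimal_idempotent S e" "G = local_group S e"
proof -
  have ideal: "matrix_ideal S I"
    using I by (auto simp: zero_minimal_ideal_def minimal_ideal_def split: if_splits)
  have IS: "I \<subseteq> S" using ideal by (simp add: matrix_ideal_def)
  have grp: "matrix_group G" using G(1) by (simp add: maximal_subgroup_def)
  obtain e where e: "e \<in> G" "e ** e = e" using matrix_group_unit[OF grp] by metis
  have eI: "e \<in> I" and e0: "e \<noteq> 0" using e(1) G(2) by auto
  have eseI: "e ** s ** e \<in> I" if "s \<in> S" for s
    using ideal eI IS that unfolding matrix_ideal_def by blast
  have rme: "rank_minimal_idempotent S e"
    unfolding rank_minimal_idempotent_def
    using e(2) e0 eI IS eseI minimal_ideal_constant_rank[OF I] by (auto intro!: antisym)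
  have "local_group S e \<subseteq> I" using eseI by (auto simp: local_group_def)
  moreover have "matrix_group (local_group S e)"
    using group_local_group[OF S rme] by (auto simp: matrix_group_def)
  moreover have "G \<subseteq> local_group S e"
    using grp G(2) IS e e0 by (intro matrix_group_subset_local_group) auto
  ultimately have "local_group S e = G" using G(1) by (simp add: maximal_subgroup_def)
  then show thesis using that rme by blast
qed

theorem theorem5:
  fixes S :: "(rat ^ 'n ^ 'n) set"
  assumes "matrix_semigroup S"
    and "finite S"
    and "matrix_irreducible S"
    and "S \<noteq> {0}"
  shows "card S \<le> 3 ^ (CARD('n))\<^sup>2
    \<and> (\<forall>I G. (if 0 \<in> S then zero_minimal_ideal S I else minimal_ideal S I)
            \<and> maximal_subgroup I G \<and> G \<subseteq> I - {0} \<and> odd (card G)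
          \<longrightarrow> card S \<le> 2 ^ (CARD('n))\<^sup>2)
    \<and> (aperiodic S \<longrightarrow> card S \<le> 2 ^ (CARD('n))\<^sup>2)"
proof -
  have closed: "\<And>a b. a \<in> S \<Longrightarrow> b \<in> S \<Longrightarrow> a ** b \<in> S" and ne: "S \<noteq> {}"
    using assms(1) by (auto simp: matrix_semigroup_def)
  obtain e where e: "rank_minimal_idempotent S e"
    using ex_rank_minimal_idempotent[OF closed assms(2) ne assms(4,3)] by blast
  show ?thesis
  proof (intro conjI allI impI)
    show "card S \<le> 3 ^ (CARD('n))\<^sup>2"
      using closed assms(2,3) e by (rule card_le_3_power)
  next
    fix I G
    assume *: "(if 0 \<in> S then zero_minimal_ideal S I else minimal_ideal S I)
      \<and> maximal_subgroup I G \<and> G \<subseteq> I - {0} \<and> odd (card G)"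
    then obtain f where "rank_minimal_idempotent S f" "G = local_group S f"
      using maximal_subgroup_of_minimal_ideal[OF closed assms(2)] by metis
    then show "card S \<le> 2 ^ (CARD('n))\<^sup>2"
      using * card_le_2_power[OF closed assms(2,3)] by blast
  next
    assume "aperiodic S"
    then obtain f where "local_group S e = {f}"
      using maximal_subgroup_local_group[OF closed assms(2) e] by (auto simp: aperiodic_def)
    then show "card S \<le> 2 ^ (CARD('n))\<^sup>2"
      by (intro card_le_2_power[OF closed assms(2,3) e]) auto
  qed
qed

end
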